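(* Let $\mathcal{N}$ be a finite node set and let $x\in\mathcal{G}_{\mathcal{N}}$ be an observed network. Under the assumption of exchangeability (that is, maximizing the likelihood $P\mapsto P(x)$ over all exchangeable probability distributions $P$ on $\mathcal{G}_{\mathcal{N}}$), the maximum likelihood estimate of the Möbius parameter $z_U$ is, for every $U\in\mathcal{U}_{\mathcal{N}}\setminus\{\varnothing\}$, $$\hat z_U=\frac{\mathrm{inj}(U,x)}{\mathrm{inj}(U,K_{\mathcal{N}})}=t_{\mathrm{inj}}(U,x).$$
   Context: $\mathcal{G}_{\mathcal{N}}$ is the set of all simple, undirected, labeled graphs with node set $\mathcal{N}$. A distribution $P$ on $\mathcal{G}_{\mathcal{N}}$ is exchangeable if $P(x)=P(x')$ whenever $x$ and $x'$ are isomorphic. $\mathcal{U}_{\mathcal{N}}$ is the set of unlabeled graphs on $\mathcal{N}$ (isomorphism classes of $\mathcal{G}_{\mathcal{N}}$), $[U]$ is the isomorphism class corresponding to $U$, and $\varnothing$ is the graph with no edges. For a random network $X$ with exchangeable distribution $P$, the Möbius parameters are $z_U=\mathbb{P}(B\subseteq X)$ for any $B\in[U]$, where $B\subseteq X$ means every edge of $B$ is an edge of $X$. $K_{\mathcal{N}}$ is the complete graph on $\mathcal{N}$. $\mathrm{inj}(F,G)$ is the number of injective graph homomorphisms from $F$ to $G$ (injective maps $V_F\to V_G$ sending edges to edges), and the injective homomorphism density is $t_{\mathrm{inj}}(F,G)=\mathrm{inj}(F,G)\,(|V_G|-|V_F|)!/|V_G|!$. In these expressions $U$ is represented by a graph without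 isolated nodes. *)

theory Defs
  imports "HOL-Probability.Probability" "HOL-Library.Ramsey"
begin

text \<open>Graphs are pairs of a node set and a set of edges, an edge being a two-element set of
  nodes. The term \<open>nsets N 2\<close> is the set of all two-element subsets of \<open>N\<close>.\<close>

type_synonym 'a graph = "'a set \<times> 'a set set"

abbreviation nodes :: "'a graph \<Rightarrow> 'a set" where
  "nodes \<equiv> fst"

abbreviation edges :: "'a graph \<Rightarrow> 'a set set" where
  "edges \<equiv> snd"

definition labeled_graphs :: "'a set \<Rightarrow> 'a graph set" where
  "labeled_graphs N = {G. nodes G = N \<and> edges G \<subseteq> nsets N 2}"

definition empty_sgraph :: "'a set \<Rightarrow> 'a graph" where
  "empty_sgraph N = (N, {})"

definition complete_sgraph :: "'a set \<Rightarrow> 'a graph" where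
  "complete_sgraph N = (N, nsets N 2)"

definition isomorphic :: "'a graph \<Rightarrow> 'b graph \<Rightarrow> bool" where
  "isomorphic G H \<longleftrightarrow>
     (\<exists>f. bij_betw f (nodes G) (nodes H) \<and> (\<lambda>e. f ` e) ` edges G = edges H)"

definition iso_rel :: "'a set \<Rightarrow> 'a graph rel" where
  "iso_rel N = {(G, H). G \<in> labeled_graphs N \<and> H \<in> labeled_graphs N \<and> isomorphic G H}"

text \<open>An unlabeled graph \<open>U\<close> is identified with its isomorphism class \<open>[U]\<close>.\<close>

definition unlabeled_graphs :: "'a set \<Rightarrow> 'a graph set set" where
  "unlabeled_graphs N = labeled_graphs N // iso_rel N"

definition unlabeled_empty :: "'a set \<Rightarrow> 'a graph set" where
  "unlabeled_empty N = iso_rel N `` {empty_sgraph N}"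

definition exchangeable :: "'a set \<Rightarrow> 'a graph pmf \<Rightarrow> bool" where
  "exchangeable N P \<longleftrightarrow> set_pmf P \<subseteq> labeled_graphs N \<and>
     (\<forall>x\<in>labeled_graphs N. \<forall>x'\<in>labeled_graphs N. isomorphic x x' \<longrightarrow> pmf P x = pmf P x')"

definition is_mle :: "'a set \<Rightarrow> 'a graph \<Rightarrow> 'a graph pmf \<Rightarrow> bool" where
  "is_mle N x P \<longleftrightarrow> is_arg_max (\<lambda>Q. pmf Q x) (exchangeable N) P"

text \<open>For an exchangeable distribution the probability below does not depend on the choice of
  \<open>B\<close> in the class; see \<open>mobius_parameter_eq\<close>.\<close>

definition mobius_parameter :: "'a graph pmf \<Rightarrow> 'a graph set \<Rightarrow> real" where
  "mobius_parameter P U =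
     (THE z. \<forall>B\<in>U. measure_pmf.prob P {X. edges B \<subseteq> edges X} = z)"

definition inj_homs :: "'a graph \<Rightarrow> 'b graph \<Rightarrow> ('a \<Rightarrow> 'b) set" where
  "inj_homs F G = {f \<in> nodes F \<rightarrow>\<^sub>E nodes G. inj_on f (nodes F) \<and> (\<forall>e\<in>edges F. f ` e \<in> edges G)}"

definition inj_count :: "'a graph \<Rightarrow> 'b graph \<Rightarrow> nat" where
  "inj_count F G = card (inj_homs F G)"

definition t_inj :: "'a graph \<Rightarrow> 'b graph \<Rightarrow> real" where
  "t_inj F G = real (inj_count F G) * fact (card (nodes G) - card (nodes F)) / fact (card (nodes G))"

definition remove_isolated :: "'a graph \<Rightarrow> 'a graph" where
  "remove_isolated G = (\<Union>(edges G), edges G)"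

lemma isomorphic_prob_eq:
  assumes fin: "finite N" and P: "exchangeable N P"
    and B: "B \<in> labeled_graphs N" and B': "B' \<in> labeled_graphs N" and iso: "isomorphic B B'"
  shows "measure_pmf.prob P {X. edges B \<subseteq> edges X} = measure_pmf.prob P {X. edges B' \<subseteq> edges X}"
proof -
  from iso B B' obtain f where f: "bij_betw f N N" and fB: "(`) f ` edges B = edges B'"
    unfolding isomorphic_def labeled_graphs_def by auto
  define g where "g X = (N, (`) f ` edges X)" for X :: "'a graph"
  let ?G = "labeled_graphs N"
  have G_eq: "?G = {N} \<times> Pow (nsets N 2)"
    unfolding labeled_graphs_def by auto
  have finG: "finite ?G"
    using fin unfolding G_eq by (simp add: finite_imp_finite_nsets)
  have inj_nsets: "inj_on ((`) f) (nsets N 2)"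
    by (rule inj_on_subset[OF inj_on_image_Pow[of f N]])
      (use f in \<open>auto simp: bij_betw_def nsets_def\<close>)
  have maps: "f ` e \<in> nsets N 2" if "e \<in> nsets N 2" for e
  proof -
    have "card (f ` e) = card e"
      using that f by (intro card_image) (auto simp: nsets_def bij_betw_def intro: inj_on_subset)
    then show ?thesis using that f by (auto simp: nsets_def bij_betw_def)
  qed
  have g_in: "g X \<in> ?G" if "X \<in> ?G" for X
    using that maps unfolding g_def labeled_graphs_def by auto
  have g_inj: "inj_on g ?G"
  proof (rule inj_onI)
    fix X Y assume XY: "X \<in> ?G" "Y \<in> ?G" "g X = g Y"
    then have "edges X = edges Y"
      using inj_on_image_eq_iff[OF inj_nsets, of "edges X" "edges Y"]
      by (auto simp: g_def labeled_graphs_def)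
    with XY show "X = Y" by (auto simp: labeled_graphs_def prod_eq_iff)
  qed
  have bij: "bij_betw g ?G ?G"
    unfolding bij_betw_def using g_inj g_in endo_inj_surj[OF finG _ g_inj] by blast
  have sub: "edges B' \<subseteq> edges (g X) \<longleftrightarrow> edges B \<subseteq> edges X" if "X \<in> ?G" for X
    using inj_on_image_subset_iff[OF inj_nsets, of "edges B" "edges X"] that B
    by (simp add: g_def fB[symmetric] labeled_graphs_def)
  have same: "pmf P (g X) = pmf P X" if "X \<in> ?G" for X
  proof -
    have "isomorphic X (g X)"
      unfolding isomorphic_def using f that by (auto simp: g_def labeled_graphs_def)
    then show ?thesis using P that g_in unfolding exchangeable_def by metis
  qed
  have prob: "measure_pmf.prob P {X. edges C \<subseteq> edges X} =
      (\<Sum>X\<in>?G. if edges C \<subseteq> edges X then pmf P X else 0)" for C :: "'a graph"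
  proof -
    have "measure_pmf.prob P {X. edges C \<subseteq> edges X} =
        measure_pmf.prob P {X \<in> ?G. edges C \<subseteq> edges X}"
      using P by (intro measure_pmf.finite_measure_eq_AE AE_pmfI) (auto simp: exchangeable_def)
    also have "\<dots> = (\<Sum>X\<in>{X \<in> ?G. edges C \<subseteq> edges X}. pmf P X)"
      using finG by (intro measure_measure_pmf_finite) simp
    also have "\<dots> = (\<Sum>X\<in>?G. if edges C \<subseteq> edges X then pmf P X else 0)"
      using finG by (rule sum.inter_filter)
    finally show ?thesis .
  qed
  have "(\<Sum>X\<in>?G. if edges B' \<subseteq> edges X then pmf P X else 0) =
      (\<Sum>X\<in>?G. if edges B' \<subseteq> edges (g X) then pmf P (g X) else 0)"
    by (rule sum.reindex_bij_betw[OF bij, symmetric])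
  also have "\<dots> = (\<Sum>X\<in>?G. if edges B \<subseteq> edges X then pmf P X else 0)"
    using sub same by (intro sum.cong) auto
  finally show ?thesis unfolding prob by simp
qed

lemma mobius_parameter_eq:
  assumes fin: "finite N" and P: "exchangeable N P"
    and U: "U \<in> unlabeled_graphs N" and B: "B \<in> U"
  shows "mobius_parameter P U = measure_pmf.prob P {X. edges B \<subseteq> edges X}"
proof -
  from U obtain C where C: "C \<in> labeled_graphs N" and UC: "U = iso_rel N `` {C}"
    unfolding unlabeled_graphs_def by (auto elim: quotientE)
  have eq: "measure_pmf.prob P {X. edges A \<subseteq> edges X} = measure_pmf.prob P {X. edges C \<subseteq> edges X}"
    if "A \<in> U" for A
    using isomorphic_prob_eq[OF fin P C, of A] that unfolding UC iso_rel_def by auto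
  show ?thesis
    unfolding mobius_parameter_def
  proof (rule the_equality)
    show "\<forall>A\<in>U. measure_pmf.prob P {X. edges A \<subseteq> edges X} =
        measure_pmf.prob P {X. edges B \<subseteq> edges X}"
      using eq eq[OF B] by simp
  qed (use B in auto)
qed

end

theory Submission
  imports Defs
begin

text \<open>An exchangeable \<open>P\<close> is constant on the isomorphism class of \<open>x\<close>, so the class has
  probability \<open>k * P x\<close>, where \<open>k\<close> is its size. Hence \<open>P x \<le> 1 / k\<close>, with equality exactly when
  \<open>P\<close> is supported on the class; the uniform distribution on the class attains the bound. This
  is \<open>is_mle_iff\<close>.

  The Moebius parameters enter through an averaging identity that holds for every exchangeable
  \<open>P\<close> (\<open>expectation_inj_count\<close>). Let \<open>F\<close> be the graph \<open>B\<close> without its isolated nodes. An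
  injective homomorphism from \<open>F\<close> to a graph \<open>X\<close> on \<open>N\<close> is an injection \<open>f\<close> of the nodes of \<open>F\<close>
  into \<open>N\<close> for which the copy of \<open>B\<close> moved by \<open>f\<close> is contained in \<open>X\<close>. Every such copy is
  isomorphic to \<open>B\<close>, so each \<open>f\<close> contributes the same probability, and the expected number of
  injective homomorphisms from \<open>F\<close> to \<open>X\<close> is \<open>inj(F, K\<^sub>N)\<close> times the Moebius parameter of
  \<open>B\<close>. Under a maximum likelihood estimate \<open>X\<close> is almost surely isomorphic to \<open>x\<close>, and so the
  expectation is just \<open>inj(F, x)\<close>.\<close>

section \<open>Isomorphism classes of graphs on a fixed node set\<close>

lemma finite_labeled_graphs:
  assumes "finite N"
  shows "finite (labeled_graphs N)"
proof -
  have "labeled_graphs N = {N} \<times> Pow (nsets N 2)"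
    unfolding labeled_graphs_def by auto
  then show ?thesis
    using assms by (simp add: finite_imp_finite_nsets)
qed

lemma isomorphic_refl: "isomorphic G G"
  unfolding isomorphic_def by (rule exI[of _ id]) auto

lemma isomorphic_sym:
  assumes "isomorphic G H" and "edges G \<subseteq> Pow (nodes G)"
  shows "isomorphic H G"
proof -
  obtain f where f: "bij_betw f (nodes G) (nodes H)" and e: "(`) f ` edges G = edges H"
    using assms(1) unfolding isomorphic_def by auto
  let ?g = "inv_into (nodes G) f"
  have "?g ` f ` d = d" if "d \<in> edges G" for d
    using f assms(2) that by (intro inv_into_image_cancel) (auto simp: bij_betw_def)
  then have "(`) ?g ` edges H = edges G"
    unfolding e[symmetric] image_image by simp
  then show ?thesis
    unfolding isomorphic_def using bij_betw_inv_into[OF f] by blast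
qed

lemma isomorphic_trans:
  assumes "isomorphic G H" and "isomorphic H K"
  shows "isomorphic G K"
proof -
  obtain f g where f: "bij_betw f (nodes G) (nodes H)" "(`) f ` edges G = edges H"
    and g: "bij_betw g (nodes H) (nodes K)" "(`) g ` edges H = edges K"
    using assms unfolding isomorphic_def by auto
  have "(`) (g \<circ> f) ` edges G = edges K"
    unfolding f(2)[symmetric] g(2)[symmetric] by (simp add: image_image image_comp)
  then show ?thesis
    unfolding isomorphic_def using bij_betw_trans[OF f(1) g(1)] by blast
qed

lemma labeled_graphs_isomorphic_sym:
  assumes "G \<in> labeled_graphs N" and "isomorphic G H"
  shows "isomorphic H G"
  by (rule isomorphic_sym[OF assms(2)]) (use assms(1) in \<open>auto simp: labeled_graphs_def nsets_def\<close>)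

section \<open>The maximum likelihood estimates\<close>

definition iso_class :: "'a set \<Rightarrow> 'a graph \<Rightarrow> 'a graph set" where
  "iso_class N x = {y \<in> labeled_graphs N. isomorphic x y}"

lemma iso_class_finite_nonempty:
  assumes "finite N" and "x \<in> labeled_graphs N"
  shows "finite (iso_class N x)" and "x \<in> iso_class N x"
  using assms finite_labeled_graphs[of N] isomorphic_refl[of x] unfolding iso_class_def by simp_all

lemma exchangeable_uniform_iso_class:
  assumes "finite N" and x: "x \<in> labeled_graphs N"
  shows "exchangeable N (pmf_of_set (iso_class N x))"
proof -
  have C: "finite (iso_class N x)" "iso_class N x \<noteq> {}"
    using iso_class_finite_nonempty[OF assms] by auto
  have "y \<in> iso_class N x \<longleftrightarrow> y' \<in> iso_class N x"
    if "y \<in> labeled_graphs N" "y' \<in> labeled_graphs N" "isomorphic y y'" for y y'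
    using that isomorphic_trans labeled_graphs_isomorphic_sym unfolding iso_class_def by blast
  then show ?thesis
    using C unfolding exchangeable_def
    by (auto simp: iso_class_def indicator_def)
qed

lemma prob_iso_class:
  assumes "finite N" and x: "x \<in> labeled_graphs N" and P: "exchangeable N P"
  shows "measure_pmf.prob P (iso_class N x) = card (iso_class N x) * pmf P x"
proof -
  have "measure_pmf.prob P (iso_class N x) = (\<Sum>y\<in>iso_class N x. pmf P y)"
    using iso_class_finite_nonempty[OF assms(1,2)] by (intro measure_measure_pmf_finite)
  also have "\<dots> = (\<Sum>y\<in>iso_class N x. pmf P x)"
  proof (rule sum.cong[OF refl])
    fix y assume "y \<in> iso_class N x"
    then have "y \<in> labeled_graphs N" "isomorphic x y"
      by (auto simp: iso_class_def)
    then show "pmf P y = pmf P x"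
      using P x unfolding exchangeable_def by simp
  qed
  finally show ?thesis by simp
qed

lemma is_mle_iff:
  assumes "finite N" and x: "x \<in> labeled_graphs N"
  shows "is_mle N x P \<longleftrightarrow> exchangeable N P \<and> set_pmf P \<subseteq> iso_class N x"
proof -
  let ?C = "iso_class N x" and ?U = "pmf_of_set (iso_class N x)"
  have C: "finite ?C" "x \<in> ?C"
    using iso_class_finite_nonempty[OF assms] by auto
  then have k: "card ?C > 0"
    by (auto simp: card_gt_0_iff)
  have U: "pmf ?U x = 1 / card ?C"
    using C by (subst pmf_of_set) auto
  have le: "pmf Q x \<le> 1 / card ?C" if "exchangeable N Q" for Q
    using prob_iso_class[OF assms that] measure_pmf.prob_le_1[of Q ?C] k
    by (simp add: field_simps)
  have supp: "pmf Q x = 1 / card ?C \<longleftrightarrow> set_pmf Q \<subseteq> ?C" if "exchangeable N Q" for Q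
  proof -
    have "pmf Q x = 1 / card ?C \<longleftrightarrow> measure_pmf.prob Q ?C = 1"
      using prob_iso_class[OF assms that] k by (simp add: field_simps)
    also have "\<dots> \<longleftrightarrow> set_pmf Q \<subseteq> ?C"
      by (subst measure_pmf.prob_eq_1) (auto simp: AE_measure_pmf_iff)
    finally show ?thesis .
  qed
  have "is_mle N x P \<longleftrightarrow> exchangeable N P \<and> pmf P x = 1 / card ?C"
  proof
    assume P: "is_mle N x P"
    then have "\<not> pmf ?U x > pmf P x" and "exchangeable N P"
      using exchangeable_uniform_iso_class[OF assms] unfolding is_mle_def is_arg_max_def by blast+
    then show "exchangeable N P \<and> pmf P x = 1 / card ?C"
      using le[of P] U by simp
  next
    assume "exchangeable N P \<and> pmf P x = 1 / card ?C"
    then show "is_mle N x P"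
      using le unfolding is_mle_def is_arg_max_def by (auto simp: not_less)
  qed
  then show ?thesis using supp by blast
qed

section \<open>Counting injective homomorphisms\<close>

lemma inj_count_le_of_isomorphic:
  assumes iso: "isomorphic G H" and F: "finite (nodes F)" "edges F \<subseteq> Pow (nodes F)"
    and H: "finite (nodes H)"
  shows "inj_count F G \<le> inj_count F H"
proof -
  obtain h where h: "bij_betw h (nodes G) (nodes H)" and e: "(`) h ` edges G = edges H"
    using iso unfolding isomorphic_def by auto
  let ?\<Phi> = "\<lambda>f. restrict (h \<circ> f) (nodes F)"
  have img: "?\<Phi> f ` d = h ` f ` d" if "d \<in> edges F" for f d
    using F(2) that by force
  show ?thesis
    unfolding inj_count_def
  proof (rule card_inj_on_le)
    show "inj_on ?\<Phi> (inj_homs F G)"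
    proof (rule inj_onI)
      fix f g assume fg: "f \<in> inj_homs F G" "g \<in> inj_homs F G" "?\<Phi> f = ?\<Phi> g"
      show "f = g"
      proof (rule PiE_ext)
        show "f \<in> nodes F \<rightarrow>\<^sub>E nodes G" "g \<in> nodes F \<rightarrow>\<^sub>E nodes G"
          using fg by (auto simp: inj_homs_def)
        fix v assume v: "v \<in> nodes F"
        with fg(3) have "h (f v) = h (g v)"
          by (metis comp_apply restrict_apply')
        then show "f v = g v"
          using h fg(1,2) v unfolding inj_homs_def bij_betw_def
          by (auto dest: inj_onD PiE_mem)
      qed
    qed
    show "?\<Phi> ` inj_homs F G \<subseteq> inj_homs F H"
    proof (rule image_subsetI)
      fix f assume f: "f \<in> inj_homs F G"
      have "f ` nodes F \<subseteq> nodes G"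
        using f by (auto simp: inj_homs_def)
      then have "inj_on (h \<circ> f) (nodes F)"
        using f h by (intro comp_inj_on) (auto simp: inj_homs_def bij_betw_def intro: inj_on_subset)
      moreover have "?\<Phi> f ` d \<in> edges H" if "d \<in> edges F" for d
        using f that unfolding img[OF that] e[symmetric] by (auto simp: inj_homs_def)
      moreover have "?\<Phi> f \<in> nodes F \<rightarrow>\<^sub>E nodes H"
        using f bij_betw_apply[OF h] by (auto simp: inj_homs_def dest: PiE_mem)
      ultimately show "?\<Phi> f \<in> inj_homs F H"
        by (simp add: inj_homs_def)
    qed
    show "finite (inj_homs F H)"
      by (rule finite_subset[of _ "nodes F \<rightarrow>\<^sub>E nodes H"])
        (use F(1) H in \<open>auto simp: inj_homs_def intro: finite_PiE\<close>)
  qed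
qed

lemma inj_count_isomorphic:
  assumes "isomorphic G H" and "edges G \<subseteq> Pow (nodes G)"
    and "finite (nodes G)" and "finite (nodes H)"
    and "finite (nodes F)" and "edges F \<subseteq> Pow (nodes F)"
  shows "inj_count F G = inj_count F H"
  using inj_count_le_of_isomorphic[OF assms(1,5,6,4)]
    inj_count_le_of_isomorphic[OF isomorphic_sym[OF assms(1,2)] assms(5,6,3)] by (rule order_antisym)

lemma remove_isolated_simps [simp]:
  "nodes (remove_isolated B) = \<Union>(edges B)" "edges (remove_isolated B) = edges B"
  by (simp_all add: remove_isolated_def)

lemma nodes_remove_isolated_subset:
  assumes "B \<in> labeled_graphs N"
  shows "\<Union>(edges B) \<subseteq> N"
  using assms by (auto simp: labeled_graphs_def nsets_def)

lemma inj_image_nsets: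
  assumes "inj_on f A" and "f ` A \<subseteq> N" and "e \<subseteq> A" and "e \<in> nsets M k"
  shows "f ` e \<in> nsets N k"
  using assms card_image[OF inj_on_subset[OF assms(1,3)]] by (auto simp: nsets_def)

lemma inj_homs_complete:
  assumes B: "B \<in> labeled_graphs N"
  shows "inj_homs (remove_isolated B) (complete_sgraph N) =
    {f \<in> \<Union>(edges B) \<rightarrow>\<^sub>E N. inj_on f (\<Union>(edges B))}"
proof -
  have "f ` e \<in> nsets N 2"
    if "f \<in> \<Union>(edges B) \<rightarrow>\<^sub>E N" "inj_on f (\<Union>(edges B))" "e \<in> edges B" for f e
    using that B by (intro inj_image_nsets[of f "\<Union>(edges B)" N e N])
      (auto simp: labeled_graphs_def)
  then show ?thesis
    unfolding inj_homs_def complete_sgraph_def by auto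
qed

lemma prod_diff_mult_fact:
  assumes "m \<le> (n::nat)"
  shows "(\<Prod>i<m. n - i) * fact (n - m) = (fact n :: nat)"
  using assms
proof (induction m)
  case (Suc m)
  then have "(fact (n - m) :: nat) = (n - m) * fact (n - Suc m)"
    by (subst fact_reduce) auto
  with Suc show ?case by (simp add: mult.assoc)
qed simp

text \<open>In a complete graph only injectivity is a constraint, so the count is a falling factorial;
  the product form keeps the identity within the natural numbers.\<close>

lemma inj_count_complete:
  assumes N: "finite N" and B: "B \<in> labeled_graphs N"
  shows "inj_count (remove_isolated B) (complete_sgraph N) * fact (card N - card (\<Union>(edges B)))
    = fact (card N)"
proof -
  let ?V = "\<Union>(edges B)"
  have V: "?V \<subseteq> N" "finite ?V"
    using nodes_remove_isolated_subset[OF B] N finite_subset by auto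
  have "inj_count (remove_isolated B) (complete_sgraph N) = (\<Prod>i<card ?V. card N - i)"
    unfolding inj_count_def inj_homs_complete[OF B]
    using card_inj_on_subset_funcset[OF V(2) N subset_refl] by (simp add: atLeast0LessThan)
  then show ?thesis
    using prod_diff_mult_fact[OF card_mono[OF N V(1)]] by simp
qed

section \<open>The averaging identity\<close>

lemma extend_inj_to_permutation:
  assumes N: "finite N" and V: "V \<subseteq> N" and f: "f ` V \<subseteq> N" "inj_on f V"
  obtains g where "bij_betw g N N" and "\<And>v. v \<in> V \<Longrightarrow> g v = f v"
proof -
  have "card (N - V) = card (N - f ` V)"
    using N V f by (simp add: card_Diff_subset finite_subset card_image)
  then obtain h where h: "bij_betw h (N - V) (N - f ` V)"
    using finite_same_card_bij[of "N - V" "N - f ` V"] N by auto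
  let ?g = "\<lambda>v. if v \<in> V then f v else h v"
  have "bij_betw ?g V (f ` V)"
    using f(2) by (auto simp: bij_betw_def inj_on_def)
  moreover have "bij_betw ?g (N - V) (N - f ` V)"
    using h by (subst bij_betw_cong[of _ _ h]) auto
  ultimately have "bij_betw ?g (V \<union> (N - V)) (f ` V \<union> (N - f ` V))"
    by (rule bij_betw_combine) auto
  then have "bij_betw ?g N N"
    using V f(1) by (simp add: Un_absorb1)
  then show ?thesis
    by (rule that) auto
qed

text \<open>The permutation extending \<open>f\<close> shows that the copy of \<open>B\<close> is isomorphic to \<open>B\<close> as a graph
  on all of \<open>N\<close>, isolated nodes included, which is what exchangeability speaks about.\<close>

lemma prob_moved_copy:
  assumes N: "finite N" and P: "exchangeable N P" and B: "B \<in> labeled_graphs N"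
    and f: "f ` \<Union>(edges B) \<subseteq> N" "inj_on f (\<Union>(edges B))"
  shows "measure_pmf.prob P {X. (`) f ` edges B \<subseteq> edges X} =
    measure_pmf.prob P {X. edges B \<subseteq> edges X}"
proof -
  obtain g where g: "bij_betw g N N" and gf: "\<And>v. v \<in> \<Union>(edges B) \<Longrightarrow> g v = f v"
    using extend_inj_to_permutation[OF N nodes_remove_isolated_subset[OF B] f] by blast
  let ?B' = "(N, (`) f ` edges B)"
  have "?B' \<in> labeled_graphs N"
    using B inj_image_nsets[OF f(2,1) Union_upper, of _ N 2]
    unfolding labeled_graphs_def by auto
  moreover have "(`) g ` edges B = (`) f ` edges B"
    using gf by (intro image_cong refl) auto
  then have "isomorphic B ?B'"
    unfolding isomorphic_def using g B by (auto simp: labeled_graphs_def)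
  ultimately show ?thesis
    using isomorphic_prob_eq[OF N P B, of ?B'] by simp
qed

text \<open>Linearity of expectation over the injections \<open>f\<close>: the count for \<open>X\<close> is the sum of the
  indicators of the events that the copy of \<open>B\<close> moved by \<open>f\<close> lies in \<open>X\<close>, and all these events
  have the same probability.\<close>

lemma expectation_inj_count:
  assumes N: "finite N" and P: "exchangeable N P" and B: "B \<in> labeled_graphs N"
  shows "measure_pmf.expectation P (\<lambda>X. real (inj_count (remove_isolated B) X)) =
    inj_count (remove_isolated B) (complete_sgraph N) * measure_pmf.prob P {X. edges B \<subseteq> edges X}"
proof -
  let ?I = "inj_homs (remove_isolated B) (complete_sgraph N)"
  let ?A = "\<lambda>f. {X::'a graph. (`) f ` edges B \<subseteq> edges X}"
  have V: "\<Union>(edges B) \<subseteq> N" "finite (\<Union>(edges B))"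
    using nodes_remove_isolated_subset[OF B] N finite_subset by auto
  have finI: "finite ?I"
    unfolding inj_homs_complete[OF B]
    by (rule finite_subset[of _ "\<Union>(edges B) \<rightarrow>\<^sub>E N"]) (use N V in \<open>auto intro: finite_PiE\<close>)
  have count: "real (inj_count (remove_isolated B) X) = (\<Sum>f\<in>?I. indicat_real (?A f) X)"
    if X: "X \<in> labeled_graphs N" for X
  proof -
    have "inj_homs (remove_isolated B) X = ?I \<inter> {f. X \<in> ?A f}"
      using X unfolding inj_homs_complete[OF B] unfolding inj_homs_def labeled_graphs_def
      by auto
    then show ?thesis
      using finI by (simp add: inj_count_def indicator_def sum.If_cases)
  qed
  have "measure_pmf.expectation P (\<lambda>X. real (inj_count (remove_isolated B) X)) =
      measure_pmf.expectation P (\<lambda>X. \<Sum>f\<in>?I. indicat_real (?A f) X)"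
    using P count by (intro integral_cong_AE AE_pmfI) (auto simp: exchangeable_def)
  also have "\<dots> = (\<Sum>f\<in>?I. measure_pmf.prob P (?A f))"
    by (subst Bochner_Integration.integral_sum) (auto simp: measure_pmf.emeasure_eq_measure)
  also have "\<dots> = (\<Sum>f\<in>?I. measure_pmf.prob P {X. edges B \<subseteq> edges X})"
    by (intro sum.cong refl prob_moved_copy[OF N P B])
      (auto simp: inj_homs_complete[OF B])
  finally show ?thesis
    by (simp add: inj_count_def)
qed

theorem mainTheorem2:
  fixes N :: "'a set" and x :: "'a graph"
  assumes "finite N" and "x \<in> labeled_graphs N"
  shows "(\<exists>P. is_mle N x P) \<and>
    (\<forall>P. is_mle N x P \<longrightarrow>
      (\<forall>U \<in> unlabeled_graphs N - {unlabeled_empty N}. \<forall>B \<in> U.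
         mobius_parameter P U =
           real (inj_count (remove_isolated B) x)
             / real (inj_count (remove_isolated B) (complete_sgraph N)) \<and>
         real (inj_count (remove_isolated B) x)
             / real (inj_count (remove_isolated B) (complete_sgraph N)) =
           t_inj (remove_isolated B) x))"
proof -
  note N = assms(1) and x = assms(2)
  have "is_mle N x (pmf_of_set (iso_class N x))"
    using is_mle_iff[OF assms] exchangeable_uniform_iso_class[OF assms]
      iso_class_finite_nonempty[OF assms] set_pmf_of_set[of "iso_class N x"] by blast
  moreover have "mobius_parameter P U =
        real (inj_count (remove_isolated B) x) / real (inj_count (remove_isolated B) (complete_sgraph N)) \<and>
      real (inj_count (remove_isolated B) x) / real (inj_count (remove_isolated B) (complete_sgraph N)) =
        t_inj (remove_isolated B) x"
    if mle: "is_mle N x P" and U: "U \<in> unlabeled_graphs N" and BU: "B \<in> U" for P U B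
  proof -
    let ?F = "remove_isolated B" and ?K = "complete_sgraph N"
    have P: "exchangeable N P" "set_pmf P \<subseteq> iso_class N x"
      using mle is_mle_iff[OF assms] by auto
    have B: "B \<in> labeled_graphs N"
      using U BU unfolding unlabeled_graphs_def iso_rel_def by (auto elim: quotientE)
    have "finite (\<Union>(edges B))"
      using nodes_remove_isolated_subset[OF B] N finite_subset by auto
    then have same: "inj_count ?F X = inj_count ?F x" if "X \<in> set_pmf P" for X
      using that P(2) x N
      by (intro inj_count_isomorphic[symmetric])
        (auto simp: iso_class_def labeled_graphs_def nsets_def)
    have "measure_pmf.expectation P (\<lambda>X. real (inj_count ?F X)) =
        measure_pmf.expectation P (\<lambda>X. real (inj_count ?F x))"
      using same by (intro integral_cong_AE AE_pmfI) auto
    then have avg: "real (inj_count ?F x) =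
        inj_count ?F ?K * measure_pmf.prob P {X. edges B \<subseteq> edges X}"
      using expectation_inj_count[OF N P(1) B] by simp
    have K: "real (inj_count ?F ?K) * fact (card N - card (\<Union>(edges B))) = fact (card N)"
      using inj_count_complete[OF N B] by (metis of_nat_fact of_nat_mult)
    then have "inj_count ?F ?K \<noteq> 0"
      by (metis fact_nonzero mult_zero_left of_nat_0)
    then have "mobius_parameter P U = inj_count ?F x / inj_count ?F ?K"
      using avg mobius_parameter_eq[OF N P(1) U BU] by simp
    moreover have "inj_count ?F x / inj_count ?F ?K = t_inj ?F x"
    proof -
      have "nodes x = N" using x by (simp add: labeled_graphs_def)
      then show ?thesis
        using \<open>inj_count ?F ?K \<noteq> 0\<close> unfolding t_inj_def by (simp add: K[symmetric])
    qed
    ultimately show ?thesis ..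
  qed
  ultimately show ?thesis by blast
qed

end
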